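(* Let $(P_n)_{n\ge1}$ be a sequence of probability measures on $C[0,1]$ with its Borel $\sigma$-algebra. The sequence $(P_n)$ is tight if and only if the following two conditions hold: (i) $\lim_{a\to\infty}\limsup_{n\to\infty}P_n(x:|x(0)|\ge a)=0$; (ii) $\lim_{\delta\to0}\limsup_{n\to\infty}P_n(x:w_x(\delta)\ge\epsilon)=0$ for each $\epsilon>0$.
   Context: $C[0,1]$ is the space of continuous functions $x:[0,1]\to\mathbb R$ with the uniform metric $\rho(x,y)=\sup_{0\le t\le1}|x(t)-y(t)|$. The modulus of continuity is $w_x(\delta)=\sup_{|s-t|\le\delta}|x(s)-x(t)|$ (with $s,t\in[0,1]$), $\delta\in(0,1]$. A sequence of probability measures $(P_n)$ on a metric space is tight if for every $\epsilon>0$ there is a compact set $K$ with $P_n(K)>1-\epsilon$ for all $n$. *)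

theory Defs
  imports "HOL-Probability.Probability"
begin

text \<open>
  The library's space of bounded continuous functions with the uniform metric. Its points are
  extensional: a function on \<open>[0,1]\<close> is represented by the real function that is
  \<^const>\<open>undefined\<close> off \<open>[0,1]\<close>. The two lemmas below unfold points and distance.
\<close>
definition C01 :: "(real \<Rightarrow> real) metric" where
  "C01 = cfunspace (top_of_set {0..1}) euclidean_metric"

lemma mspace_C01: "mspace C01 = {x \<in> extensional {0..1}. continuous_on {0..1} x}"
proof -
  have "compactin (top_of_set {0..1::real}) (topspace (top_of_set {0..1::real}))"
    by (simp add: compactin_subtopology)
  then show ?thesis
    unfolding C01_def by (subst compactin_mspace_cfunspace) (auto simp: extensional_def)
qed

lemma mdist_C01:
  assumes "x \<in> mspace C01" "y \<in> mspace C01"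
  shows "mdist C01 x y = (SUP t\<in>{0..1}. \<bar>x t - y t\<bar>)"
  using assms unfolding C01_def
  by (auto simp: mdist_cfunspace_eq_mdist_funspace Metric_space.fdist_def Metric_space.fspace_def
      Met_TC.fdist_def Met_TC.fspace_def dist_real_def)

definition modulus :: "(real \<Rightarrow> real) \<Rightarrow> real \<Rightarrow> real" where
  "modulus x \<delta> = (SUP (s, t) \<in> {(s, t). s \<in> {0..1} \<and> t \<in> {0..1} \<and> \<bar>s - t\<bar> \<le> \<delta>}. \<bar>x s - x t\<bar>)"

definition metric_borel :: "'a metric \<Rightarrow> 'a measure" where
  "metric_borel m = sigma (mspace m) {U. openin (mtopology_of m) U}"

definition tight_seq :: "'a metric \<Rightarrow> (nat \<Rightarrow> 'a measure) \<Rightarrow> bool" where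
  "tight_seq m P \<longleftrightarrow>
     (\<forall>\<epsilon>>0. \<exists>K. compactin (mtopology_of m) K \<and> (\<forall>n. measure (P n) K > 1 - \<epsilon>))"

end

theory Submission
  imports Defs "HOL-Complex_Analysis.Great_Picard"
begin

text \<open>
  The sets \<open>{x. \<bar>x 0\<bar> \<ge> a}\<close> for growing \<open>a\<close>, and \<open>{x. modulus x \<delta> \<ge> \<epsilon>}\<close> for shrinking
  \<open>\<delta>\<close>, are decreasing families of closed sets with empty intersection: every path is finite at
  \<open>0\<close> and uniformly continuous. Two facts hold for any such family. First, a compact set misses
  some member, by the open cover of complements. Second, each single finite measure gives the
  members mass tending to \<open>0\<close>, by continuity from above. The second fact takes care of any finite
  number of indices \<open>n\<close>, so that the limsup in \<open>n\<close> tends to \<open>0\<close> if and only if for every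
  \<open>e > 0\<close> one member has mass below \<open>e\<close> under all measures of the sequence
  (\<open>limsup_escaping_iff_uniform\<close>).

  Tightness gives this uniform smallness at once: the member missed by a compact set of mass above
  \<open>1 - e\<close> has mass below \<open>e\<close> (\<open>tight_imp_uniform_escaping\<close>). Conversely, uniform
  smallness yields a bound \<open>a\<close> on \<open>\<bar>x 0\<bar>\<close> and scales \<open>\<delta>\<^sub>k\<close> with
  \<open>modulus x \<delta>\<^sub>k \<le> 1 / (k + 1)\<close> that each fail with small probability, of sum at most
  \<open>\<epsilon>\<close>. The paths that meet all these constraints form an equicontinuous, pointwise bounded closed set,
  which is compact by the Arzela-Ascoli theorem (\<open>compactin_equicontinuous_paths\<close>).
\<close>

section \<open>Families of closed sets that escape to the empty set\<close>

text \<open>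
  The index runs over the positive reals towards infinity. A family that shrinks as \<open>\<delta>\<close> decreases to
  \<open>0\<close> fits this form after the substitution \<open>\<delta> = inverse a\<close>.
\<close>
definition escaping :: "'a topology \<Rightarrow> (real \<Rightarrow> 'a set) \<Rightarrow> bool" where
  "escaping X F \<longleftrightarrow> (\<forall>a>0. closedin X (F a)) \<and> (\<forall>a b. 0 < a \<longrightarrow> a \<le> b \<longrightarrow> F b \<subseteq> F a) \<and>
     (\<forall>x\<in>topspace X. \<exists>a>0. x \<notin> F a)"

text \<open>
  The complements form an open cover that is increasing in the index, so a finite subcover has
  a largest member.
\<close>
lemma compact_avoids_escaping:
  assumes F: "escaping X F" and K: "compactin X K"
  shows "\<exists>a>0. K \<inter> F a = {}"
proof -
  let ?U = "(\<lambda>a. topspace X - F a) ` {0<..}"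
  have "K \<subseteq> \<Union>?U"
  proof
    fix x assume "x \<in> K"
    then have x: "x \<in> topspace X" using compactin_subset_topspace[OF K] by blast
    then obtain a where "a > 0" "x \<notin> F a" using F unfolding escaping_def by blast
    with x show "x \<in> \<Union>?U" by auto
  qed
  moreover have "openin X U" if "U \<in> ?U" for U
    using that F by (auto simp: escaping_def)
  ultimately obtain \<F> where "finite \<F>" "\<F> \<subseteq> ?U" and KF: "K \<subseteq> \<Union>\<F>"
    using compactinD[OF K, of ?U] by metis
  then obtain A where A: "finite A" "A \<subseteq> {0<..}" "\<F> = (\<lambda>a. topspace X - F a) ` A"
    by (meson finite_subset_image)
  \<comment> \<open>\<open>A\<close> can be empty, namely for empty \<open>K\<close>; the extra element keeps the maximum defined and positive.\<close>
  define b where "b = Max (insert 1 A)"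
  have b: "b \<ge> a" if "a \<in> insert 1 A" for a
    unfolding b_def using that A(1) by (intro Max_ge) auto
  then have "b > 0" by force
  moreover have "x \<notin> F b" if "x \<in> K" for x
  proof -
    have "x \<in> (\<Union>a\<in>A. topspace X - F a)" using that KF A(3) by blast
    then obtain a where "a \<in> A" "x \<notin> F a" by blast
    with b[of a] A(2) F show ?thesis unfolding escaping_def by (metis greaterThan_iff insertCI subset_iff)
  qed
  ultimately show ?thesis by blast
qed

text \<open>
  Continuity from above along the integers gives the limit; monotonicity extends it to real
  indices.
\<close>
lemma measure_escaping_tendsto_0:
  assumes F: "escaping X F" and "finite_measure M" and sp: "space M = topspace X"
    and sets: "\<And>C. closedin X C \<Longrightarrow> C \<in> sets M"
  shows "((\<lambda>a. measure M (F a)) \<longlongrightarrow> 0) at_top"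
proof (rule decreasing_tendsto)
  interpret finite_measure M by fact
  show "\<forall>\<^sub>F a in at_top. 0 \<le> measure M (F a)" by simp
  fix e :: real assume "0 < e"
  let ?A = "\<lambda>i. F (real (Suc i))"
  have meas: "F a \<in> sets M" if "a > 0" for a
    using F sets that by (auto simp: escaping_def)
  have mono: "F b \<subseteq> F a" if "0 < a" "a \<le> b" for a b
    using F that by (auto simp: escaping_def)
  have "(\<Inter>i. ?A i) = {}"
  proof (rule equals0I)
    fix x assume x: "x \<in> (\<Inter>i. ?A i)"
    then have "x \<in> F 1" by (metis INT_D One_nat_def UNIV_I of_nat_1)
    then have "x \<in> topspace X"
      using F closedin_subset[of X "F 1"] by (auto simp: escaping_def)
    then obtain a where a: "a > 0" "x \<notin> F a" using F by (auto simp: escaping_def)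
    obtain i where "a < real i" using reals_Archimedean2 by blast
    with mono[of a "real (Suc i)"] x a show False by fastforce
  qed
  moreover have "(\<lambda>i. measure M (?A i)) \<longlonglongrightarrow> measure M (\<Inter>i. ?A i)"
    using mono meas by (intro finite_Lim_measure_decseq) (auto simp: decseq_def)
  ultimately have "\<forall>\<^sub>F i in sequentially. measure M (?A i) < e"
    using \<open>0 < e\<close> by (intro order_tendstoD(2)[of _ 0]) auto
  then obtain i where i: "measure M (?A i) < e" by (auto simp: eventually_sequentially)
  show "\<forall>\<^sub>F a in at_top. measure M (F a) < e"
  proof (rule eventually_mono[OF eventually_ge_at_top[of "real (Suc i)"]])
    fix a assume "real (Suc i) \<le> a"
    then have "measure M (F a) \<le> measure M (?A i)"
      by (intro finite_measure_mono mono meas) auto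
    with i show "measure M (F a) < e" by simp
  qed
qed

text \<open>
  A limsup below \<open>e\<close> at one index controls all but finitely many measures. The remaining ones are
  controlled one at a time by \<open>measure_escaping_tendsto_0\<close>, and enlarging the index keeps the first bound because the
  family decreases.
\<close>
lemma limsup_escaping_iff_uniform:
  fixes P :: "nat \<Rightarrow> 'a measure"
  assumes F: "escaping X F" and P: "\<And>n. finite_measure (P n)"
    and sp: "\<And>n. space (P n) = topspace X"
    and sets: "\<And>n C. closedin X C \<Longrightarrow> C \<in> sets (P n)"
  shows "((\<lambda>a. limsup (\<lambda>n. ereal (measure (P n) (F a)))) \<longlongrightarrow> 0) at_top \<longleftrightarrow>
    (\<forall>e>0. \<exists>a>0. \<forall>n. measure (P n) (F a) < e)" (is "?L \<longleftrightarrow> ?R")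
proof
  assume ?R
  show ?L
  proof (rule order_tendstoI)
    fix l :: ereal assume "l < 0"
    moreover have "0 \<le> limsup (\<lambda>n. ereal (measure (P n) (F a)))" for a
      by (intro le_Limsup) auto
    ultimately show "\<forall>\<^sub>F a in at_top. l < limsup (\<lambda>n. ereal (measure (P n) (F a)))"
      by (simp add: less_le_trans)
  next
    fix u :: ereal assume "0 < u"
    then obtain e where e: "0 < ereal e" "ereal e < u" using ereal_dense2 by blast
    then obtain a where a: "a > 0" "\<And>n. measure (P n) (F a) < e"
      using \<open>?R\<close> by (metis ereal_less(2))
    show "\<forall>\<^sub>F a in at_top. limsup (\<lambda>n. ereal (measure (P n) (F a))) < u"
    proof (rule eventually_mono[OF eventually_ge_at_top[of a]])
      fix b assume "a \<le> b"
      have "measure (P n) (F b) \<le> e" for n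
      proof -
        have "measure (P n) (F b) \<le> measure (P n) (F a)"
          using F P sets a(1) \<open>a \<le> b\<close>
          by (intro finite_measure.finite_measure_mono) (auto simp: escaping_def)
        with a(2)[of n] show ?thesis by simp
      qed
      then have "limsup (\<lambda>n. ereal (measure (P n) (F b))) \<le> ereal e"
        by (intro Limsup_bounded) simp
      with e(2) show "limsup (\<lambda>n. ereal (measure (P n) (F b))) < u" by simp
    qed
  qed
next
  assume ?L
  show ?R
  proof (intro allI impI)
    fix e :: real assume "0 < e"
    then have "\<forall>\<^sub>F a in at_top. limsup (\<lambda>n. ereal (measure (P n) (F a))) < ereal e"
      by (intro order_tendstoD(2)[OF \<open>?L\<close>]) simp
    then have "\<forall>\<^sub>F a in at_top. 0 < a \<and> limsup (\<lambda>n. ereal (measure (P n) (F a))) < ereal e"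
      using eventually_conj eventually_gt_at_top by blast
    then obtain a where a: "0 < a" "limsup (\<lambda>n. ereal (measure (P n) (F a))) < ereal e"
      using eventually_happens'[OF trivial_limit_at_top_linorder] by blast
    then obtain N where N: "\<And>n. n \<ge> N \<Longrightarrow> measure (P n) (F a) < e"
      using Limsup_lessD[OF a(2)] by (auto simp: eventually_sequentially)
    have "\<forall>\<^sub>F b in at_top. \<forall>n\<in>{..<N}. measure (P n) (F b) < e"
      using \<open>0 < e\<close> order_tendstoD(2)[OF measure_escaping_tendsto_0[OF F P sp sets]]
      by (intro eventually_ball_finite) auto
    then have "\<forall>\<^sub>F b in at_top. a \<le> b \<and> (\<forall>n\<in>{..<N}. measure (P n) (F b) < e)"
      using eventually_conj eventually_ge_at_top by blast
    then obtain b where b: "a \<le> b" "\<And>n. n < N \<Longrightarrow> measure (P n) (F b) < e"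
      using eventually_happens'[OF trivial_limit_at_top_linorder] by blast
    have "measure (P n) (F b) < e" for n
    proof (cases "n < N")
      case False
      have "measure (P n) (F b) \<le> measure (P n) (F a)"
        using F P sets a(1) \<open>a \<le> b\<close>
        by (intro finite_measure.finite_measure_mono) (auto simp: escaping_def)
      with N[of n] False show ?thesis by simp
    qed (use b in auto)
    with a b show "\<exists>a>0. \<forall>n. measure (P n) (F a) < e" by (meson less_le_trans)
  qed
qed

section \<open>Borel probability measures on a metric space\<close>

lemma metric_open_sets_subset: "{U. openin (mtopology_of m) U} \<subseteq> Pow (mspace m)"
  by (metis mem_Collect_eq openin_subset PowI subsetI topspace_mtopology_of)

lemma space_eq_mspace:
  assumes "sets M = sets (metric_borel m)"
  shows "space M = mspace m"
proof -
  have "space (metric_borel m) = mspace m"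
    unfolding metric_borel_def by (rule space_measure_of[OF metric_open_sets_subset])
  with sets_eq_imp_space_eq[OF assms] show ?thesis by simp
qed

lemma closedin_in_sets_metric_borel:
  assumes "sets M = sets (metric_borel m)" "closedin (mtopology_of m) C"
  shows "C \<in> sets M"
proof -
  have "mspace m - C \<in> sets (metric_borel m)"
    using assms(2) unfolding metric_borel_def closedin_def
    by (subst sets_measure_of[OF metric_open_sets_subset]) auto
  then have "space M - (mspace m - C) \<in> sets M"
    using assms(1) by auto
  moreover have "space M - (mspace m - C) = C"
    using space_eq_mspace[OF assms(1)] assms(2) by (auto simp: closedin_def)
  ultimately show ?thesis by simp
qed

lemma tight_imp_uniform_escaping:
  fixes P :: "nat \<Rightarrow> 'a measure"
  assumes "tight_seq m P" "escaping (mtopology_of m) F"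
    and P: "\<And>n. prob_space (P n)" and sets: "\<And>n. sets (P n) = sets (metric_borel m)"
    and "e > 0"
  shows "\<exists>a>0. \<forall>n. measure (P n) (F a) < e"
proof -
  obtain K where K: "compactin (mtopology_of m) K" "\<And>n. measure (P n) K > 1 - e"
    using assms unfolding tight_seq_def by blast
  obtain a where a: "a > 0" "K \<inter> F a = {}"
    using compact_avoids_escaping[OF assms(2) K(1)] by blast
  have "Hausdorff_space (mtopology_of m)"
    by (simp add: mtopology_of_def Metric_space.Hausdorff_space_mtopology)
  then have "closedin (mtopology_of m) K" using K(1) by (rule compactin_imp_closedin)
  moreover have "closedin (mtopology_of m) (F a)" using a assms(2) by (simp add: escaping_def)
  ultimately have meas: "K \<in> sets (P n)" "F a \<in> sets (P n)" for n
    using closedin_in_sets_metric_borel[OF sets] by auto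
  have "measure (P n) (F a) < e" for n
  proof -
    interpret prob_space "P n" by (rule P)
    have "measure (P n) K + measure (P n) (F a) = measure (P n) (K \<union> F a)"
      using meas a by (simp add: finite_measure_Union)
    also have "\<dots> \<le> 1" by simp
    finally show ?thesis using K(2)[of n] by simp
  qed
  with a show ?thesis by blast
qed

text \<open>
  The inequality is required for both orders of the arguments, hence it is a Lipschitz condition in
  the one-sided form in which it is proved for suprema.
\<close>
lemma Lipschitz_imp_closed_superlevel:
  assumes "\<And>x y. x \<in> mspace m \<Longrightarrow> y \<in> mspace m \<Longrightarrow> f x \<le> f y + B * mdist m x y"
  shows "closedin (mtopology_of m) {x \<in> mspace m. (f x :: real) \<ge> c}"
proof -
  have "Lipschitz_continuous_map m euclidean_metric f"
    unfolding Lipschitz_continuous_map_def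
  proof (intro conjI exI ballI)
    fix x y assume "x \<in> mspace m" "y \<in> mspace m"
    with assms[of x y] assms[of y x] show "mdist euclidean_metric (f x) (f y) \<le> B * mdist m x y"
      by (simp add: dist_real_def mdist_commute)
  qed auto
  then have "continuous_map (mtopology_of m) euclidean f"
    by (metis Lipschitz_continuous_imp_continuous_map mtopology_of_euclidean)
  from closedin_continuous_map_preimage[OF this, of "{c..}"] show ?thesis by simp
qed

section \<open>The uniform metric and the modulus of continuity\<close>

lemma C01_abs_diff_le_mdist:
  assumes "x \<in> mspace C01" "y \<in> mspace C01" "t \<in> {0..1}"
  shows "\<bar>x t - y t\<bar> \<le> mdist C01 x y"
proof -
  have "continuous_on {0..1} (\<lambda>t. \<bar>x t - y t\<bar>)"
    using assms by (auto simp: mspace_C01 intro!: continuous_intros)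
  then have "bdd_above ((\<lambda>t. \<bar>x t - y t\<bar>) ` {0..1})"
    by (intro bounded_imp_bdd_above compact_imp_bounded compact_continuous_image) auto
  then show ?thesis
    using assms by (auto simp: mdist_C01 intro!: cSUP_upper)
qed

lemma C01_mdist_le:
  assumes "x \<in> mspace C01" "y \<in> mspace C01" "\<And>t. t \<in> {0..1} \<Longrightarrow> \<bar>x t - y t\<bar> \<le> c"
  shows "mdist C01 x y \<le> c"
  using assms by (auto simp: mdist_C01 intro!: cSUP_least)

text \<open>
  The pair \<open>(0, 0)\<close> makes the supremum range over a nonempty set exactly because
  \<open>\<delta>\<close> is nonnegative.
\<close>
lemma modulus_le:
  assumes "0 \<le> \<delta>" "\<And>s t. s \<in> {0..1} \<Longrightarrow> t \<in> {0..1} \<Longrightarrow> \<bar>s - t\<bar> \<le> \<delta> \<Longrightarrow> \<bar>x s - x t\<bar> \<le> c"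
  shows "modulus x \<delta> \<le> c"
  unfolding modulus_def
proof (rule cSUP_least)
  have "(0, 0) \<in> {(s, t). s \<in> {0..1} \<and> t \<in> {0..1} \<and> \<bar>s - t\<bar> \<le> \<delta>}"
    using assms(1) by simp
  then show "{(s, t). s \<in> {0..1} \<and> t \<in> {0..1} \<and> \<bar>s - t\<bar> \<le> \<delta>} \<noteq> {}" by blast
qed (use assms(2) in auto)

lemma abs_diff_le_modulus:
  assumes "x \<in> mspace C01" "s \<in> {0..1}" "t \<in> {0..1}" "\<bar>s - t\<bar> \<le> \<delta>"
  shows "\<bar>x s - x t\<bar> \<le> modulus x \<delta>"
proof -
  have "bounded (x ` {0..1})"
    using assms(1) by (intro compact_imp_bounded compact_continuous_image) (auto simp: mspace_C01)
  then obtain B where B: "\<And>t. t \<in> {0..1} \<Longrightarrow> \<bar>x t\<bar> \<le> B"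
    unfolding bounded_real by blast
  have "\<bar>x s - x t\<bar> \<le> 2 * B" if "s \<in> {0..1}" "t \<in> {0..1}" for s t
    using B[OF that(1)] B[OF that(2)] by linarith
  then have "bdd_above ((\<lambda>(s, t). \<bar>x s - x t\<bar>) `
      {(s, t). s \<in> {0..1} \<and> t \<in> {0..1} \<and> \<bar>s - t\<bar> \<le> \<delta>})"
    by (intro bdd_aboveI[of _ "2 * B"]) auto
  from cSUP_upper[OF _ this, of "(s, t)"] show ?thesis
    using assms by (auto simp: modulus_def)
qed

lemma modulus_mono:
  assumes "x \<in> mspace C01" "0 \<le> \<delta>" "\<delta> \<le> \<delta>'"
  shows "modulus x \<delta> \<le> modulus x \<delta>'"
  using assms by (intro modulus_le abs_diff_le_modulus) auto

lemma modulus_less_at_0: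
  assumes "x \<in> mspace C01" "0 < \<epsilon>"
  shows "\<exists>\<delta>>0. modulus x \<delta> < \<epsilon>"
proof -
  have "uniformly_continuous_on {0..1} x"
    using assms(1) by (intro compact_uniformly_continuous) (auto simp: mspace_C01)
  then obtain d where d: "d > 0"
    "\<And>s t. s \<in> {0..1} \<Longrightarrow> t \<in> {0..1} \<Longrightarrow> \<bar>s - t\<bar> < d \<Longrightarrow> \<bar>x s - x t\<bar> < \<epsilon> / 2"
    using assms(2) unfolding uniformly_continuous_on_def dist_real_def
    by (metis half_gt_zero)
  have "modulus x (d / 2) \<le> \<epsilon> / 2"
    using d(1) by (intro modulus_le less_imp_le[OF d(2)]) auto
  then have "modulus x (d / 2) < \<epsilon>" using assms(2) by simp
  with d(1) show ?thesis by (meson half_gt_zero)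
qed

text \<open>
  An increment of \<open>x\<close> differs from the same increment of \<open>y\<close> by the errors at its two
  endpoints; this is where the factor \<open>2\<close> comes from.
\<close>
lemma modulus_Lipschitz:
  assumes x: "x \<in> mspace C01" and y: "y \<in> mspace C01" and "0 \<le> \<delta>"
  shows "modulus x \<delta> \<le> modulus y \<delta> + 2 * mdist C01 x y"
proof (rule modulus_le[OF \<open>0 \<le> \<delta>\<close>])
  fix s t :: real assume st: "s \<in> {0..1}" "t \<in> {0..1}" "\<bar>s - t\<bar> \<le> \<delta>"
  show "\<bar>x s - x t\<bar> \<le> modulus y \<delta> + 2 * mdist C01 x y"
    using C01_abs_diff_le_mdist[OF x y st(1)] C01_abs_diff_le_mdist[OF x y st(2)]
      abs_diff_le_modulus[OF y st] by linarith
qed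

lemma escaping_initial_value:
  "escaping (mtopology_of C01) (\<lambda>a. {x \<in> mspace C01. \<bar>x 0\<bar> \<ge> a})"
  unfolding escaping_def
proof (intro conjI allI impI ballI)
  fix a :: real
  show "closedin (mtopology_of C01) {x \<in> mspace C01. \<bar>x 0\<bar> \<ge> a}"
  proof (rule Lipschitz_imp_closed_superlevel[where B = 1])
    fix x y assume "x \<in> mspace C01" "y \<in> mspace C01"
    from C01_abs_diff_le_mdist[OF this, of 0] show "\<bar>x 0\<bar> \<le> \<bar>y 0\<bar> + 1 * mdist C01 x y" by simp
  qed
next
  fix x :: "real \<Rightarrow> real"
  show "\<exists>a>0. x \<notin> {x \<in> mspace C01. \<bar>x 0\<bar> \<ge> a}"
    by (intro exI[of _ "\<bar>x 0\<bar> + 1"]) auto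
qed auto

lemma escaping_modulus:
  assumes "\<epsilon> > 0"
  shows "escaping (mtopology_of C01) (\<lambda>a. {x \<in> mspace C01. modulus x (inverse a) \<ge> \<epsilon>})"
  unfolding escaping_def
proof (intro conjI allI impI ballI)
  fix a :: real assume "0 < a"
  then show "closedin (mtopology_of C01) {x \<in> mspace C01. modulus x (inverse a) \<ge> \<epsilon>}"
    by (intro Lipschitz_imp_closed_superlevel[where B = 2] modulus_Lipschitz) auto
next
  fix a b :: real assume "0 < a" "a \<le> b"
  then have "modulus x (inverse b) \<le> modulus x (inverse a)" if "x \<in> mspace C01" for x
    using that by (intro modulus_mono) auto
  then show "{x \<in> mspace C01. \<epsilon> \<le> modulus x (inverse b)} \<subseteq> {x \<in> mspace C01. \<epsilon> \<le> modulus x (inverse a)}"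
    by fastforce
next
  fix x assume "x \<in> topspace (mtopology_of C01)"
  then obtain \<delta> where "\<delta> > 0" "modulus x \<delta> < \<epsilon>"
    using modulus_less_at_0[of x \<epsilon>] assms by auto
  then show "\<exists>a>0. x \<notin> {x \<in> mspace C01. modulus x (inverse a) \<ge> \<epsilon>}"
    by (intro exI[of _ "inverse \<delta>"]) auto
qed

section \<open>Compact sets of paths\<close>

text \<open>
  Chaining: \<open>t\<close> is reached from \<open>0\<close> in \<open>N\<close> equal steps of length at most \<open>\<delta>\<close>. With a bound
  on the initial value it turns a bound on the modulus into a uniform bound on the path.
\<close>
lemma abs_diff_initial_le:
  fixes x :: "real \<Rightarrow> real"
  assumes osc: "\<And>s t. s \<in> {0..1} \<Longrightarrow> t \<in> {0..1} \<Longrightarrow> \<bar>s - t\<bar> \<le> \<delta> \<Longrightarrow> \<bar>x s - x t\<bar> \<le> c"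
    and N: "1 \<le> real N * \<delta>" and t: "t \<in> {0..1}"
  shows "\<bar>x t - x 0\<bar> \<le> real N * c"
proof -
  have "N > 0" using N by (cases N) auto
  have "\<bar>x (t * real i / real N) - x 0\<bar> \<le> real i * c" if "i \<le> N" for i
    using that
  proof (induction i)
    case (Suc i)
    have mem: "t * real j / real N \<in> {0..1}" if "j \<le> N" for j
      using t that \<open>N > 0\<close> by (auto simp: divide_le_eq intro: mult_le_one order_trans[OF mult_left_le_one_le])
    have "t * real (Suc i) / real N - t * real i / real N = t / real N"
      by (simp add: distrib_left add_divide_distrib)
    moreover have "t / real N \<le> \<delta>"
      using t N \<open>N > 0\<close> by (simp add: divide_le_eq mult.commute)
    moreover have "0 \<le> t / real N" using t by simp
    ultimately have "\<bar>x (t * real (Suc i) / real N) - x (t * real i / real N)\<bar> \<le> c"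
      using Suc.prems by (intro osc mem) auto
    with Suc show ?case by (simp add: algebra_simps)
  qed simp
  from this[of N] \<open>N > 0\<close> show ?thesis by simp
qed

text \<open>
  Sequential compactness. The Arzela-Ascoli theorem extracts a uniformly convergent subsequence, and
  the defining inequalities survive even pointwise limits, so the limit stays in the set.
\<close>
lemma compactin_equicontinuous_paths:
  fixes \<delta> \<eta> :: "nat \<Rightarrow> real"
  assumes \<delta>: "\<And>k. \<delta> k > 0" and \<eta>: "\<eta> \<longlonglongrightarrow> 0"
  shows "compactin (mtopology_of C01) {x \<in> mspace C01. \<bar>x 0\<bar> \<le> a \<and> (\<forall>k. modulus x (\<delta> k) \<le> \<eta> k)}"
    (is "compactin _ ?K")
proof -
  interpret C: Metric_space "mspace C01" "mdist C01" by simp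
  have "\<exists>l r. l \<in> ?K \<and> strict_mono r \<and> limitin C.mtopology (\<sigma> \<circ> r) l sequentially"
    if "range \<sigma> \<subseteq> ?K" for \<sigma> :: "nat \<Rightarrow> real \<Rightarrow> real"
  proof -
    have \<sigma>: "\<sigma> n \<in> mspace C01" "\<bar>\<sigma> n 0\<bar> \<le> a" "modulus (\<sigma> n) (\<delta> k) \<le> \<eta> k" for n k
      using that by (auto simp: image_subset_iff)
    have osc: "\<bar>\<sigma> n s - \<sigma> n t\<bar> \<le> \<eta> k" if "s \<in> {0..1}" "t \<in> {0..1}" "\<bar>s - t\<bar> \<le> \<delta> k" for n k s t
      using abs_diff_le_modulus[OF \<sigma>(1) that, of n] \<sigma>(3)[of n k] by simp
    obtain N where "1 / \<delta> 0 \<le> real N" using real_arch_simple by blast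
    then have N: "1 \<le> real N * \<delta> 0" using \<delta>[of 0] by (simp add: divide_le_eq)
    have bdd: "norm (\<sigma> n t) \<le> a + real N * \<eta> 0" if "t \<in> {0..1}" for n t
    proof -
      have "\<bar>\<sigma> n t - \<sigma> n 0\<bar> \<le> real N * \<eta> 0"
        by (rule abs_diff_initial_le[OF _ N that]) (rule osc)
      with \<sigma>(2)[of n] show ?thesis by simp
    qed
    have equi: "\<exists>d>0. \<forall>n t. t \<in> {0..1} \<and> norm (s - t) < d \<longrightarrow> norm (\<sigma> n s - \<sigma> n t) < e"
      if "s \<in> {0..1}" "0 < e" for s e
    proof -
      have "\<forall>\<^sub>F k in sequentially. \<eta> k < e" using \<eta> \<open>0 < e\<close> by (rule order_tendstoD)
      then obtain k where "\<eta> k < e" by (auto simp: eventually_sequentially)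
      have "\<bar>\<sigma> n s - \<sigma> n t\<bar> < e" if "t \<in> {0..1}" "\<bar>s - t\<bar> < \<delta> k" for n t
        using osc[OF \<open>s \<in> {0..1}\<close> that(1) less_imp_le[OF that(2)], of n] \<open>\<eta> k < e\<close> by simp
      then show ?thesis using \<delta>[of k] by (intro exI[of _ "\<delta> k"]) auto
    qed
    obtain g r where g: "continuous_on {0..1} g" and r: "strict_mono (r :: nat \<Rightarrow> nat)"
      and conv: "\<And>e. 0 < e \<Longrightarrow> \<exists>N. \<forall>n x. n \<ge> N \<and> x \<in> {0..1} \<longrightarrow> norm (\<sigma> (r n) x - g x) < e"
      using Arzela_Ascoli[of "{0..1::real}" \<sigma>, OF _ bdd equi] by (metis compact_Icc)
    \<comment> \<open>Points of the path space are undefined off the unit interval, so \<open>g\<close> must be restricted.\<close>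
    define l where "l = restrict g {0..1}"
    have "continuous_on {0..1} l"
      using g by (rule continuous_on_eq) (simp add: l_def)
    then have lM: "l \<in> mspace C01" by (simp add: mspace_C01 l_def)
    have lim: "limitin C.mtopology (\<sigma> \<circ> r) l sequentially"
      unfolding C.limit_metric_sequentially
    proof (intro conjI lM allI impI)
      fix e :: real assume "0 < e"
      then obtain N where N: "\<And>n x. n \<ge> N \<Longrightarrow> x \<in> {0..1} \<Longrightarrow> \<bar>\<sigma> (r n) x - g x\<bar> < e / 2"
        using conv[of "e / 2"] by auto
      have "mdist C01 (\<sigma> (r n)) l \<le> e / 2" if "n \<ge> N" for n
        using N[OF that] by (intro C01_mdist_le \<sigma> lM) (auto simp: l_def intro: less_imp_le)
      then show "\<exists>N. \<forall>n\<ge>N. (\<sigma> \<circ> r) n \<in> mspace C01 \<and> mdist C01 ((\<sigma> \<circ> r) n) l < e"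
        using \<open>0 < e\<close> \<sigma>(1) by (intro exI[of _ N]) fastforce
    qed
    have pointwise: "(\<lambda>n. \<sigma> (r n) t) \<longlonglongrightarrow> l t" if "t \<in> {0..1}" for t
    proof (rule LIMSEQ_I)
      fix e :: real assume "0 < e"
      with conv that show "\<exists>N. \<forall>n\<ge>N. norm (\<sigma> (r n) t - l t) < e"
        unfolding l_def by (metis restrict_apply')
    qed
    have "\<bar>l 0\<bar> \<le> a"
      using \<sigma>(2) by (intro LIMSEQ_le_const2[OF tendsto_rabs[OF pointwise]]) auto
    moreover have "modulus l (\<delta> k) \<le> \<eta> k" for k
    proof (rule modulus_le)
      fix s t :: real assume st: "s \<in> {0..1}" "t \<in> {0..1}" "\<bar>s - t\<bar> \<le> \<delta> k"
      then show "\<bar>l s - l t\<bar> \<le> \<eta> k"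
        using osc[OF st] by (intro LIMSEQ_le_const2[OF tendsto_rabs[OF tendsto_diff[OF pointwise pointwise]]]) auto
    qed (use \<delta>[of k] in simp)
    ultimately show ?thesis using lM r lim by blast
  qed
  then show ?thesis unfolding mtopology_of_def C.compactin_sequentially by blast
qed

section \<open>Tightness\<close>

text \<open>
  Half of the allowed mass \<open>\<epsilon>\<close> is spent on the initial value, the other half on the countably many
  moduli with geometric weights \<open>w k\<close>. The exceptional sets are superlevel sets with \<open>\<ge>\<close>, and \<open>K\<close> is
  defined with \<open>\<le>\<close>: it contains the complement of their union and is closed.
\<close>
lemma uniform_imp_tight_C01:
  assumes P: "\<And>n. prob_space (P n)" and sets: "\<And>n. sets (P n) = sets (metric_borel C01)"
    and init: "\<And>e. e > 0 \<Longrightarrow> \<exists>a>0. \<forall>n. measure (P n) {x \<in> mspace C01. \<bar>x 0\<bar> \<ge> a} < e"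
    and osc: "\<And>\<epsilon> e. \<epsilon> > 0 \<Longrightarrow> e > 0 \<Longrightarrow>
      \<exists>b>0. \<forall>n. measure (P n) {x \<in> mspace C01. modulus x (inverse b) \<ge> \<epsilon>} < e"
  shows "tight_seq C01 P"
  unfolding tight_seq_def
proof (intro allI impI)
  fix \<epsilon> :: real assume "0 < \<epsilon>"
  define \<eta> where "\<eta> k = 1 / real (Suc k)" for k
  define w where "w k = \<epsilon> / 2 * (1 / 2) ^ Suc k" for k
  obtain a where a: "a > 0" "\<And>n. measure (P n) {x \<in> mspace C01. \<bar>x 0\<bar> \<ge> a} < \<epsilon> / 2"
    using init[of "\<epsilon> / 2"] \<open>0 < \<epsilon>\<close> by auto
  have "\<exists>b>0. \<forall>n. measure (P n) {x \<in> mspace C01. modulus x (inverse b) \<ge> \<eta> k} < w k" for k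
    using \<open>0 < \<epsilon>\<close> by (intro osc) (auto simp: \<eta>_def w_def)
  then obtain b where b: "\<And>k. b k > 0"
    "\<And>k n. measure (P n) {x \<in> mspace C01. modulus x (inverse (b k)) \<ge> \<eta> k} < w k"
    by metis
  define A where "A = {x \<in> mspace C01. \<bar>x 0\<bar> \<ge> a}"
  define B where "B k = {x \<in> mspace C01. modulus x (inverse (b k)) \<ge> \<eta> k}" for k
  define K where "K = {x \<in> mspace C01. \<bar>x 0\<bar> \<le> a \<and> (\<forall>k. modulus x (inverse (b k)) \<le> \<eta> k)}"
  have K: "compactin (mtopology_of C01) K"
    unfolding K_def using b(1) LIMSEQ_inverse_real_of_nat
    by (intro compactin_equicontinuous_paths) (auto simp: \<eta>_def inverse_eq_divide)
  have "closedin (mtopology_of C01) A"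
    using escaping_initial_value a(1) by (simp add: A_def escaping_def)
  moreover have "closedin (mtopology_of C01) (B k)" for k
    using escaping_modulus[of "\<eta> k"] b(1)[of k] by (simp add: B_def \<eta>_def escaping_def)
  moreover have "Hausdorff_space (mtopology_of C01)"
    by (simp add: mtopology_of_def Metric_space.Hausdorff_space_mtopology)
  then have "closedin (mtopology_of C01) K" using K by (rule compactin_imp_closedin)
  ultimately have meas: "A \<in> sets (P n)" "B k \<in> sets (P n)" "K \<in> sets (P n)" for n k
    using closedin_in_sets_metric_borel[OF sets] by auto
  have "w sums (\<epsilon> / 2 * 1)"
    unfolding w_def by (intro sums_mult power_half_series)
  then have w: "summable w" "suminf w = \<epsilon> / 2"
    by (auto simp: sums_iff)
  have "measure (P n) K > 1 - \<epsilon>" for n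
  proof -
    interpret prob_space "P n" by (rule P)
    have sB: "summable (\<lambda>k. measure (P n) (B k))"
      using b(2) by (intro summable_comparison_test'[OF w(1)]) (auto simp: B_def intro: less_imp_le)
    have "measure (P n) (\<Union>k. B k) \<le> (\<Sum>k. measure (P n) (B k))"
      using meas sB by (intro finite_measure_subadditive_countably) auto
    also have "\<dots> \<le> suminf w"
      using b(2) sB w(1) by (intro suminf_le) (auto simp: B_def intro: less_imp_le)
    finally have UB: "measure (P n) (\<Union>k. B k) \<le> \<epsilon> / 2" using w by simp
    have "x \<in> A \<union> (\<Union>k. B k)" if x: "x \<in> mspace C01" "x \<notin> K" for x
    proof -
      have "\<bar>x 0\<bar> > a \<or> (\<exists>k. modulus x (inverse (b k)) > \<eta> k)"
        using x by (auto simp: K_def not_le)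
      then show ?thesis using x(1) by (auto simp: A_def B_def intro: less_imp_le)
    qed
    then have "space (P n) - K \<subseteq> A \<union> (\<Union>k. B k)"
      unfolding space_eq_mspace[OF sets] by blast
    then have "measure (P n) (space (P n) - K) \<le> measure (P n) (A \<union> (\<Union>k. B k))"
      using meas by (intro finite_measure_mono) auto
    also have "\<dots> \<le> measure (P n) A + measure (P n) (\<Union>k. B k)"
      using meas by (intro measure_Un_le) auto
    also have "\<dots> < \<epsilon>" using a(2)[of n] UB by (simp add: A_def)
    finally show ?thesis using prob_compl[OF meas(3)] by simp
  qed
  with K show "\<exists>K. compactin (mtopology_of C01) K \<and> (\<forall>n. measure (P n) K > 1 - \<epsilon>)" by blast
qed

theorem theorem4p25:
  fixes P :: "nat \<Rightarrow> (real \<Rightarrow> real) measure"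
  assumes "\<And>n. prob_space (P n)"
    and "\<And>n. sets (P n) = sets (metric_borel C01)"
  shows "tight_seq C01 P \<longleftrightarrow>
    ((\<lambda>a::real. limsup (\<lambda>n. ereal (measure (P n) {x \<in> mspace C01. \<bar>x 0\<bar> \<ge> a}))) \<longlongrightarrow> 0) at_top \<and>
    (\<forall>\<epsilon>>0. ((\<lambda>\<delta>::real. limsup (\<lambda>n. ereal (measure (P n) {x \<in> mspace C01. modulus x \<delta> \<ge> \<epsilon>})))
        \<longlongrightarrow> 0) (at_right 0))"
proof -
  have uniform: "((\<lambda>a. limsup (\<lambda>n. ereal (measure (P n) (F a)))) \<longlongrightarrow> 0) at_top \<longleftrightarrow>
      (\<forall>e>0. \<exists>a>0. \<forall>n. measure (P n) (F a) < e)" if "escaping (mtopology_of C01) F" for F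
    using that assms
    by (intro limsup_escaping_iff_uniform)
       (auto simp: space_eq_mspace prob_space.finite_measure intro: closedin_in_sets_metric_borel)
  have "tight_seq C01 P \<longleftrightarrow>
      (\<forall>e>0. \<exists>a>0. \<forall>n. measure (P n) {x \<in> mspace C01. \<bar>x 0\<bar> \<ge> a} < e) \<and>
      (\<forall>\<epsilon>>0. \<forall>e>0. \<exists>b>0. \<forall>n. measure (P n) {x \<in> mspace C01. modulus x (inverse b) \<ge> \<epsilon>} < e)"
    (is "_ \<longleftrightarrow> ?init \<and> ?osc")
  proof
    assume tight: "tight_seq C01 P"
    show "?init \<and> ?osc"
      by (intro conjI allI impI tight_imp_uniform_escaping[OF tight _ assms]
          escaping_initial_value escaping_modulus)
  next
    assume "?init \<and> ?osc"
    then show "tight_seq C01 P" by (intro uniform_imp_tight_C01[OF assms]) simp_all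
  qed
  then show ?thesis
    by (simp add: filterlim_at_right_to_top uniform escaping_initial_value escaping_modulus)
qed

end
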